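(* Let $T:X\to X$ be a homeomorphism of a compact metric space $X$, let $l\ge1$, let $\Psi:X\to U(l)$ and $\rho:X\to\mathbb{R}^l$ be continuous, and let $I$ be the cocycle by isometries of $\mathbb{R}^l$ over $T$ generated by $I(x)v=\Psi(x)v+\rho(x)$. For $\lambda\in[0,1)$ let $u_\lambda:X\to\mathbb{R}^l$ be the unique continuous solution of $\lambda u_\lambda(Tx)-\Psi(x)u_\lambda(x)=\rho(x)$ for all $x\in X$. If the maximal drift satisfies $D(T,I)=0$, then $$\lim_{\lambda\to1^-}|u_\lambda(Tx)-\Psi(x)u_\lambda(x)-\rho(x)|=0$$ uniformly in $x\in X$.
   Context: $U(l)$ denotes the orthogonal group of $\mathbb{R}^l$. The cocycle is given by $I(1,x)=I(x)$ and $I(n,x)=I(n-1,Tx)\circ I(x)$, so for $n\ge1$, $I(n,x)=I(T^{n-1}x)\circ\cdots\circ I(Tx)\circ I(x)$. The maximal drift is $D(T,I):=\lim_{n\to\infty}\frac1n\sup_{x\in X}|v_0-I(n,x)v_0|$ for some $v_0\in\mathbb{R}^l$; the limit exists by subadditivity and does not depend on $v_0$. The unique continuous solution of the hyperbolized equation is $u_\lambda(x)=-\sum_{j\ge0}\lambda^j\Psi(x)^{-1}\Psi(Tx)^{-1}\cdots\Psi(T^jx)^{-1}\rho(T^jx)$. *)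

theory Defs
  imports "HOL-Analysis.Analysis"
begin

primrec cocycle :: "('a \<Rightarrow> 'a) \<Rightarrow> ('a \<Rightarrow> 'v \<Rightarrow> 'v) \<Rightarrow> nat \<Rightarrow> 'a \<Rightarrow> 'v \<Rightarrow> 'v" where
  "cocycle T I 0 x = id"
| "cocycle T I (Suc n) x = cocycle T I n (T x) \<circ> I x"

definition affine_generator ::
  "('a \<Rightarrow> real^'n^'n) \<Rightarrow> ('a \<Rightarrow> real^'n) \<Rightarrow> 'a \<Rightarrow> real^'n \<Rightarrow> real^'n" where
  "affine_generator \<Psi> \<rho> x v = \<Psi> x *v v + \<rho> x"

(* The base point v0 is an explicit argument. For a continuous cocycle of isometries over a
   continuous self-map of a compact set X, the suprema are finite, the limit exists, and its
   value does not depend on v0. *)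
definition max_drift ::
  "'a set \<Rightarrow> ('a \<Rightarrow> 'a) \<Rightarrow> ('a \<Rightarrow> 'v \<Rightarrow> 'v) \<Rightarrow> 'v::real_normed_vector \<Rightarrow> real" where
  "max_drift X T I v0 = lim (\<lambda>n. 1 / real n * (SUP x\<in>X. norm (v0 - cocycle T I n x v0)))"

(* For 0 \<le> lam < 1 there is exactly one such u, up to its irrelevant values outside X. *)
definition hyperbolized_solution ::
  "'a::metric_space set \<Rightarrow> ('a \<Rightarrow> 'a) \<Rightarrow> ('a \<Rightarrow> real^'n^'n) \<Rightarrow> ('a \<Rightarrow> real^'n) \<Rightarrow> real \<Rightarrow>
    ('a \<Rightarrow> real^'n) \<Rightarrow> bool" where
  "hyperbolized_solution X T \<Psi> \<rho> lam u \<longleftrightarrow>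
     continuous_on X u \<and> (\<forall>x\<in>X. lam *\<^sub>R u (T x) - \<Psi> x *v u x = \<rho> x)"

end

theory Submission
  imports Defs
begin

text \<open>
  Since \<open>u\<^sub>\<lambda>(Tx) - \<Psi>(x) u\<^sub>\<lambda>(x) - \<rho>(x) = (1 - \<lambda>) u\<^sub>\<lambda>(Tx)\<close>, it suffices to bound
  \<open>(1 - \<lambda>) M\<close>, where \<open>M = sup |u\<^sub>\<lambda>|\<close>. The hyperbolized equation shows that
  \<open>I(N,x) u\<^sub>\<lambda>(x)\<close> differs from \<open>\<lambda>^N u\<^sub>\<lambda>(T^N x)\<close> by at most
  \<open>N (1 - \<lambda>^N) sup |\<rho>|\<close>. As \<open>I(N,x)\<close> is an isometry moving \<open>v0\<close> by at most its
  maximal displacement \<open>a\<^sub>N\<close>, this gives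
  \<open>(1 - \<lambda>^N) M \<le> a\<^sub>N + 2 |v0| + N (1 - \<lambda>^N) sup |\<rho>|\<close>. Dividing by
  \<open>1 + \<lambda> + \<dots> + \<lambda>^(N-1)\<close> and letting \<open>\<lambda> \<rightarrow> 1\<close> for fixed \<open>N\<close>, the right-hand side
  tends to \<open>(a\<^sub>N + 2 |v0|) / N\<close>, which is small for large \<open>N\<close> because the drift vanishes.
\<close>

section \<open>Fekete's subadditive lemma\<close>

lemma subadditive_le_mult_add:
  fixes a :: "nat \<Rightarrow> real"
  assumes "\<And>m n. a (m + n) \<le> a m + a n"
  shows "a (k * N + r) \<le> real k * a N + a r"
proof (induction k)
  case (Suc k)
  have "a (Suc k * N + r) \<le> a N + a (k * N + r)"
    using assms[of N "k * N + r"] by (simp add: add.assoc)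
  with Suc show ?case by (simp add: algebra_simps)
qed simp

text \<open>The limit is the infimum of \<open>a n / n\<close>: dividing \<open>n\<close> with
  remainder by an almost optimal \<open>N\<close> bounds \<open>a n / n\<close> by
  \<open>a N / N\<close> plus a vanishing remainder.\<close>

lemma fekete_subadditive_convergent:
  fixes a :: "nat \<Rightarrow> real"
  assumes sub: "\<And>m n. a (m + n) \<le> a m + a n" and nonneg: "\<And>n. 0 \<le> a n"
  shows "convergent (\<lambda>n. 1 / real n * a n)"
proof -
  \<comment> \<open>Index 0 must stay out: \<open>a 0 / 0 = 0\<close> would make the infimum
    0.\<close>
  define L where "L = (INF n\<in>{1..}. a n / real n)"
  have bdd: "bdd_below ((\<lambda>n. a n / real n) ` {1..})"
    by (rule bdd_belowI[of _ 0]) (auto simp: nonneg)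
  have lower: "L \<le> a n / real n" if "n \<ge> 1" for n
    unfolding L_def using that by (intro cINF_lower bdd) auto
  have "(\<lambda>n. a n / real n) \<longlonglongrightarrow> L"
  proof (rule LIMSEQ_I)
    fix e :: real assume "0 < e"
    then have "\<exists>N\<in>{1..}. a N / real N < L + e / 2"
      unfolding L_def by (subst cINF_less_iff[symmetric]) (use bdd in auto)
    then obtain N where N: "N \<ge> 1" "a N / real N < L + e / 2" by auto
    define C where "C = Max (a ` {..<N})"
    have C: "a r \<le> C" if "r < N" for r
      unfolding C_def using that by (intro Max_ge) auto
    have "(\<lambda>n. C / real n) \<longlonglongrightarrow> 0"
      by (rule lim_const_over_n)
    then have "\<forall>\<^sub>F n in sequentially. C / real n < e / 2"
      using \<open>0 < e\<close> by (intro order_tendstoD) auto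
    then have "\<forall>\<^sub>F n in sequentially. norm (a n / real n - L) < e"
      using eventually_ge_at_top[of 1]
    proof eventually_elim
      case (elim n)
      have "a n \<le> real (n div N) * a N + a (n mod N)"
        using subadditive_le_mult_add[of a "n div N" N "n mod N", OF sub] by simp
      \<comment> \<open>Replacing the integer quotient by \<open>n / N\<close> uses
        \<open>0 \<le> a N\<close>; \<open>C\<close> bounds the finitely many possible remainder
        terms.\<close>
      also have "\<dots> \<le> real n / real N * a N + C"
        using N C by (intro add_mono mult_right_mono nonneg) (auto simp: of_nat_div_le_of_nat)
      finally have "a n / real n \<le> (real n / real N * a N + C) / real n"
        by (intro divide_right_mono) auto
      also have "\<dots> = a N / real N + C / real n"
        using N elim by (simp add: field_simps)
      finally have "a n / real n < L + e"
        using N elim by linarith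
      moreover have "L \<le> a n / real n"
        using lower elim by simp
      ultimately show ?case by simp
    qed
    then show "\<exists>n0. \<forall>n\<ge>n0. norm (a n / real n - L) < e"
      by (simp add: eventually_sequentially)
  qed
  then show ?thesis
    by (auto simp: convergent_def)
qed

section \<open>Cocycles of isometries and their drift\<close>

lemma cocycle_add:
  "cocycle T I (m + n) x v = cocycle T I n ((T ^^ m) x) (cocycle T I m x v)"
  by (induction m arbitrary: x v) (simp_all add: funpow_swap1)

lemma cocycle_Suc_right:
  "cocycle T I (Suc n) x v = I ((T ^^ n) x) (cocycle T I n x v)"
  using cocycle_add[of T I n 1] by simp

lemma funpow_in:
  assumes "T \<in> X \<rightarrow> X" "x \<in> X"
  shows "(T ^^ n) x \<in> X"
  using assms by (induction n) auto

lemma cocycle_isometry: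
  fixes I :: "'a \<Rightarrow> 'v::real_normed_vector \<Rightarrow> 'v"
  assumes T: "T \<in> X \<rightarrow> X" and x: "x \<in> X"
    and iso: "\<And>x v w. x \<in> X \<Longrightarrow> norm (I x v - I x w) = norm (v - w)"
  shows "norm (cocycle T I n x v - cocycle T I n x w) = norm (v - w)"
  using x T by (induction n arbitrary: x v w) (auto simp: iso Pi_iff)

text \<open>Insert \<open>?C v\<close> between the two points: the isometry \<open>?C\<close>
  preserves the displacement of the first \<open>m\<close> steps. Taking suprema over
  \<open>x\<close> then gives a subadditive sequence.\<close>

lemma cocycle_displacement_add:
  fixes I :: "'a \<Rightarrow> 'v::real_normed_vector \<Rightarrow> 'v"
  assumes T: "T \<in> X \<rightarrow> X" and x: "x \<in> X"
    and iso: "\<And>x v w. x \<in> X \<Longrightarrow> norm (I x v - I x w) = norm (v - w)"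
  shows "norm (v - cocycle T I (m + n) x v)
    \<le> norm (v - cocycle T I m x v) + norm (v - cocycle T I n ((T ^^ m) x) v)"
proof -
  let ?C = "cocycle T I n ((T ^^ m) x)"
  have "norm (?C v - ?C (cocycle T I m x v)) = norm (v - cocycle T I m x v)"
    by (rule cocycle_isometry[OF T funpow_in[OF T x] iso])
  then show ?thesis
    unfolding cocycle_add
    using norm_triangle_ineq[of "v - ?C v" "?C v - ?C (cocycle T I m x v)"] by simp
qed

lemma cocycle_displacement_le:
  fixes I :: "'a \<Rightarrow> 'v::real_normed_vector \<Rightarrow> 'v"
  assumes T: "T \<in> X \<rightarrow> X" and x: "x \<in> X"
    and iso: "\<And>x v w. x \<in> X \<Longrightarrow> norm (I x v - I x w) = norm (v - w)"
    and K: "\<And>x. x \<in> X \<Longrightarrow> norm (v - I x v) \<le> K"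
  shows "norm (v - cocycle T I n x v) \<le> real n * K"
proof (induction n)
  case (Suc n)
  have "norm (v - cocycle T I (n + 1) x v)
      \<le> norm (v - cocycle T I n x v) + norm (v - cocycle T I 1 ((T ^^ n) x) v)"
    by (rule cocycle_displacement_add[OF T x iso])
  also have "\<dots> \<le> real n * K + K"
    using Suc K[OF funpow_in[OF T x]] by (intro add_mono) auto
  finally show ?case by (simp add: algebra_simps)
qed simp

text \<open>Both \<open>SUP\<close> and \<open>lim\<close> are informative only for bounded sets and
  convergent sequences. The one-step bound \<open>K\<close> makes every supremum finite, and
  Fekete's lemma makes \<open>max_drift\<close> a genuine limit.\<close>

lemma isometric_cocycle_max_drift:
  fixes I :: "'a \<Rightarrow> 'v::real_normed_vector \<Rightarrow> 'v"
  assumes T: "T \<in> X \<rightarrow> X" and "X \<noteq> {}"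
    and iso: "\<And>x v w. x \<in> X \<Longrightarrow> norm (I x v - I x w) = norm (v - w)"
    and K: "\<And>x. x \<in> X \<Longrightarrow> norm (v - I x v) \<le> K"
  shows "(\<lambda>n. 1 / real n * (SUP x\<in>X. norm (v - cocycle T I n x v))) \<longlonglongrightarrow> max_drift X T I v"
    and "x \<in> X \<Longrightarrow> norm (v - cocycle T I n x v) \<le> (SUP x\<in>X. norm (v - cocycle T I n x v))"
proof -
  define a where "a n = (SUP x\<in>X. norm (v - cocycle T I n x v))" for n
  have upper: "norm (v - cocycle T I n x v) \<le> a n" if "x \<in> X" for n x
    unfolding a_def using that cocycle_displacement_le[OF T _ iso K]
    by (intro cSUP_upper bdd_aboveI2) auto
  have "a (m + n) \<le> a m + a n" for m n
    unfolding a_def[of "m + n"] using \<open>X \<noteq> {}\<close>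
  proof (rule cSUP_least)
    fix x assume x: "x \<in> X"
    show "norm (v - cocycle T I (m + n) x v) \<le> a m + a n"
      using cocycle_displacement_add[where I = I and v = v and m = m and n = n, OF T x iso]
        upper[OF x, of m] upper[OF funpow_in[OF T x], of n m] by linarith
  qed
  moreover have "0 \<le> a n" for n
    using \<open>X \<noteq> {}\<close> upper by (metis all_not_in_conv norm_ge_zero order_trans)
  ultimately have "convergent (\<lambda>n. 1 / real n * a n)"
    by (rule fekete_subadditive_convergent)
  then show "(\<lambda>n. 1 / real n * (SUP x\<in>X. norm (v - cocycle T I n x v))) \<longlonglongrightarrow> max_drift X T I v"
    unfolding max_drift_def a_def by (simp add: convergent_LIMSEQ_iff)
  show "norm (v - cocycle T I n x v) \<le> (SUP x\<in>X. norm (v - cocycle T I n x v))" if "x \<in> X"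
    using upper[OF that, of n] by (simp add: a_def)
qed

section \<open>The affine cocycle and the hyperbolized equation\<close>

lemma norm_orthogonal_matrix_mult:
  fixes A :: "real^'n^'n"
  assumes "orthogonal_matrix A"
  shows "norm (A *v v) = norm v"
proof -
  have "orthogonal_transformation ((*v) A)"
    using assms by (simp add: orthogonal_transformation_matrix)
  then show ?thesis by (rule orthogonal_transformation_norm)
qed

lemma norm_affine_generator_diff:
  assumes "orthogonal_matrix (\<Psi> x)"
  shows "norm (affine_generator \<Psi> \<rho> x v - affine_generator \<Psi> \<rho> x w) = norm (v - w)"
  using norm_orthogonal_matrix_mult[OF assms, of "v - w"]
  by (simp add: affine_generator_def matrix_vector_mult_diff_distrib)

text \<open>Passing from \<open>n\<close> to \<open>Suc n\<close> rotates the error by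
  \<open>\<Psi> ?y\<close> and adds \<open>(1 - lam ^ n) *\<^sub>R \<rho> ?y\<close>. The factors
  \<open>1 - lam ^ j\<close> increase with \<open>j\<close>, so the sum of the added terms is at
  most \<open>n\<close> times the last bound.\<close>

lemma norm_cocycle_diff_scaled_solution_le:
  assumes T: "T \<in> X \<rightarrow> X" and x: "x \<in> X"
    and orth: "\<And>x. x \<in> X \<Longrightarrow> orthogonal_matrix (\<Psi> x)"
    and R: "\<And>x. x \<in> X \<Longrightarrow> norm (\<rho> x) \<le> R"
    and lam: "lam \<in> {0..<1}"
    and eq: "\<And>x. x \<in> X \<Longrightarrow> lam *\<^sub>R u (T x) - \<Psi> x *v u x = \<rho> x"
  shows "norm (cocycle T (affine_generator \<Psi> \<rho>) n x (u x) - lam ^ n *\<^sub>R u ((T ^^ n) x))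
    \<le> real n * (1 - lam ^ n) * R"
proof (induction n)
  case (Suc n)
  let ?w = "cocycle T (affine_generator \<Psi> \<rho>) n x (u x)"
  let ?y = "(T ^^ n) x"
  have y: "?y \<in> X" by (rule funpow_in[OF T x])
  have R0: "0 \<le> R"
    using R[OF x] norm_ge_zero order_trans by blast
  have pow: "0 \<le> lam ^ Suc n" "lam ^ Suc n \<le> lam ^ n" "lam ^ n \<le> 1"
    using lam by (auto intro: power_le_one mult_left_le_one_le)
  have "lam ^ Suc n *\<^sub>R u (T ?y) = lam ^ n *\<^sub>R (lam *\<^sub>R u (T ?y))"
    by simp
  also have "lam *\<^sub>R u (T ?y) = \<Psi> ?y *v u ?y + \<rho> ?y"
    using eq[OF y] by (simp add: algebra_simps)
  finally have "cocycle T (affine_generator \<Psi> \<rho>) (Suc n) x (u x) - lam ^ Suc n *\<^sub>R u ((T ^^ Suc n) x)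
      = \<Psi> ?y *v (?w - lam ^ n *\<^sub>R u ?y) + (1 - lam ^ n) *\<^sub>R \<rho> ?y"
    unfolding cocycle_Suc_right
    by (simp add: affine_generator_def matrix_vector_mult_diff_distrib
        matrix_vector_mult_scaleR algebra_simps)
  also have "norm \<dots> \<le> norm (?w - lam ^ n *\<^sub>R u ?y) + (1 - lam ^ n) * norm (\<rho> ?y)"
    using norm_triangle_ineq[of "\<Psi> ?y *v (?w - lam ^ n *\<^sub>R u ?y)" "(1 - lam ^ n) *\<^sub>R \<rho> ?y"] pow
    by (simp add: norm_orthogonal_matrix_mult[OF orth[OF y]])
  also have "\<dots> \<le> real n * (1 - lam ^ n) * R + (1 - lam ^ n) * R"
    using Suc R[OF y] pow by (intro add_mono mult_left_mono) auto
  also have "\<dots> = real (Suc n) * (1 - lam ^ n) * R"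
    by (simp add: algebra_simps)
  also have "\<dots> \<le> real (Suc n) * (1 - lam ^ Suc n) * R"
    using pow R0 by (intro mult_right_mono mult_left_mono) auto
  finally show ?case .
qed simp

lemma norm_hyperbolized_solution_le:
  assumes "compact X" and T: "T \<in> X \<rightarrow> X"
    and orth: "\<And>x. x \<in> X \<Longrightarrow> orthogonal_matrix (\<Psi> x)"
    and R: "\<And>x. x \<in> X \<Longrightarrow> norm (\<rho> x) \<le> R"
    and lam: "lam \<in> {0..<1}"
    and sol: "hyperbolized_solution X T \<Psi> \<rho> lam u"
    and A: "\<And>x. x \<in> X \<Longrightarrow> norm (v0 - cocycle T (affine_generator \<Psi> \<rho>) n x v0) \<le> A"
    and n: "n > 0" and x: "x \<in> X"
  shows "(1 - lam) * norm (u x) \<le> (A + 2 * norm v0 + real n * (1 - lam ^ n) * R) / (\<Sum>j<n. lam ^ j)"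
proof -
  let ?I = "cocycle T (affine_generator \<Psi> \<rho>) n"
  from sol have cont: "continuous_on X u"
    and eq: "\<And>x. x \<in> X \<Longrightarrow> lam *\<^sub>R u (T x) - \<Psi> x *v u x = \<rho> x"
    by (auto simp: hyperbolized_solution_def)
  \<comment> \<open>At a maximum point \<open>z\<close> of the norm of \<open>u\<close>, the value
    at \<open>(T ^^ n) z\<close> is bounded by the same \<open>norm (u z)\<close>, so the estimate
    closes up.\<close>
  obtain z where z: "z \<in> X" "\<And>y. y \<in> X \<Longrightarrow> norm (u y) \<le> norm (u z)"
    using continuous_attains_sup[OF \<open>compact X\<close> _ continuous_on_norm[OF cont]] x by blast
  have "norm (u z - v0) = norm (?I z (u z) - ?I z v0)"
    by (rule cocycle_isometry[OF T z(1), symmetric]) (intro norm_affine_generator_diff orth)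
  moreover have "norm (lam ^ n *\<^sub>R u ((T ^^ n) z)) \<le> lam ^ n * norm (u z)"
    using z(2)[OF funpow_in[OF T z(1)]] lam by (simp add: mult_left_mono)
  moreover have "norm (?I z (u z) - lam ^ n *\<^sub>R u ((T ^^ n) z)) \<le> real n * (1 - lam ^ n) * R"
    by (rule norm_cocycle_diff_scaled_solution_le[where \<Psi> = \<Psi> and \<rho> = \<rho> and u = u, OF T z(1) orth R lam eq])
  \<comment> \<open>One \<open>norm v0\<close> comes from comparing \<open>u z\<close> with
    \<open>v0\<close>, the other from comparing \<open>?I z v0\<close> with
    \<open>v0\<close>.\<close>
  ultimately have "norm (u z) \<le> A + 2 * norm v0 + real n * (1 - lam ^ n) * R + lam ^ n * norm (u z)"
    using A[OF z(1)] norm_triangle_sub[of "u z" v0] norm_triangle_ineq4[of "?I z (u z)" "?I z v0"]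
      norm_triangle_sub[of "?I z (u z)" "lam ^ n *\<^sub>R u ((T ^^ n) z)"]
      norm_triangle_sub[of "?I z v0" v0] norm_minus_commute[of v0 "?I z v0"]
    by linarith
  \<comment> \<open>Splitting off the geometric sum leaves a divisor that tends to \<open>n\<close>,
    not to 0, as \<open>lam\<close> tends to 1.\<close>
  moreover have "(1 - lam ^ n) * norm (u z) = (1 - lam) * norm (u z) * (\<Sum>j<n. lam ^ j)"
    by (simp add: one_diff_power_eq)
  ultimately have "(1 - lam) * norm (u z) * (\<Sum>j<n. lam ^ j)
      \<le> A + 2 * norm v0 + real n * (1 - lam ^ n) * R"
    by (simp add: algebra_simps)
  moreover have "0 < (\<Sum>j<n. lam ^ j)"
    by (rule sum_pos2[of _ 0]) (use n lam in auto)
  ultimately have "(1 - lam) * norm (u z)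
      \<le> (A + 2 * norm v0 + real n * (1 - lam ^ n) * R) / (\<Sum>j<n. lam ^ j)"
    by (simp add: pos_le_divide_eq)
  moreover have "(1 - lam) * norm (u x) \<le> (1 - lam) * norm (u z)"
    using z(2)[OF x] lam by (intro mult_left_mono) auto
  ultimately show ?thesis by linarith
qed

theorem theorem24:
  fixes X :: "'a::metric_space set"
    and T T' :: "'a \<Rightarrow> 'a"
    and \<Psi> :: "'a \<Rightarrow> real^'n^'n"
    and \<rho> :: "'a \<Rightarrow> real^'n"
    and u :: "real \<Rightarrow> 'a \<Rightarrow> real^'n"
    and v0 :: "real^'n"
  assumes "compact X"
    and "homeomorphism X X T T'"
    and "continuous_on X \<Psi>"
    and "\<And>x. x \<in> X \<Longrightarrow> orthogonal_matrix (\<Psi> x)"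
    and "continuous_on X \<rho>"
    and "\<And>lam. lam \<in> {0..<1} \<Longrightarrow> hyperbolized_solution X T \<Psi> \<rho> lam (u lam)"
    and "max_drift X T (affine_generator \<Psi> \<rho>) v0 = 0"
  shows "uniform_limit X (\<lambda>lam x. norm (u lam (T x) - \<Psi> x *v u lam x - \<rho> x)) (\<lambda>x. 0) (at_left 1)"
proof (cases "X = {}")
  \<comment> \<open>The supremum over an empty set is unspecified, so the drift says nothing here;
    the claim is vacuous.\<close>
  case True
  then show ?thesis by (simp add: uniform_limit_iff)
next
  case False
  note orth = assms(4) and sol = assms(6)
  let ?I = "affine_generator \<Psi> \<rho>"
  define a where "a n = (SUP x\<in>X. norm (v0 - cocycle T ?I n x v0))" for n
  have T: "T \<in> X \<rightarrow> X"
    using assms(2) by (auto simp: homeomorphism_def)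
  obtain R where R: "\<And>x. x \<in> X \<Longrightarrow> norm (\<rho> x) \<le> R"
    using compact_imp_bounded[OF compact_continuous_image[OF assms(5,1)]]
    by (auto simp: bounded_iff)
  have iso: "norm (?I x v - ?I x w) = norm (v - w)" if "x \<in> X" for x v w
    by (intro norm_affine_generator_diff orth that)
  have K: "norm (v0 - ?I x v0) \<le> 2 * norm v0 + R" if "x \<in> X" for x
    using norm_triangle_ineq4[of v0 "?I x v0"] norm_triangle_ineq[of "\<Psi> x *v v0" "\<rho> x"] R[OF that]
    by (simp add: affine_generator_def norm_orthogonal_matrix_mult[OF orth[OF that]])
  have upper: "norm (v0 - cocycle T ?I n x v0) \<le> a n" if "x \<in> X" for x n
    unfolding a_def by (rule isometric_cocycle_max_drift(2)[OF T False iso K that])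
  have "(\<lambda>n. 1 / real n * a n) \<longlonglongrightarrow> 0"
    using isometric_cocycle_max_drift(1)[where I = ?I and v = v0, OF T False iso K] assms(7) by (simp add: a_def)
  then have "(\<lambda>n. 1 / real n * a n + 2 * norm v0 / real n) \<longlonglongrightarrow> 0 + 0"
    by (intro tendsto_add lim_const_over_n)
  then have small: "(\<lambda>n. (a n + 2 * norm v0) / real n) \<longlonglongrightarrow> 0"
    by (simp add: add_divide_distrib)
  show ?thesis
    unfolding uniform_limit_iff
  proof (intro allI impI)
    fix e :: real assume "0 < e"
    with small have "\<forall>\<^sub>F n in sequentially. (a n + 2 * norm v0) / real n < e"
      by (intro order_tendstoD)
    then have "\<exists>n. (a n + 2 * norm v0) / real n < e \<and> n > 0"
      using eventually_gt_at_top[of 0]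
      by (intro eventually_happens'[OF sequentially_bot] eventually_conj)
    \<comment> \<open>\<open>n\<close> is fixed before \<open>lam\<close> moves: the bound is small
      only in this order of limits.\<close>
    then obtain n where n: "(a n + 2 * norm v0) / real n < e" "n > 0" by blast
    define B where "B lam = (a n + 2 * norm v0 + real n * (1 - lam ^ n) * R) / (\<Sum>j<n. lam ^ j)"
      for lam :: real
    have "(B \<longlongrightarrow> (a n + 2 * norm v0 + real n * (1 - 1 ^ n) * R) / (\<Sum>j<n. 1 ^ j)) (at_left 1)"
      unfolding B_def using n(2) by (intro tendsto_intros) auto
    then have "(B \<longlongrightarrow> (a n + 2 * norm v0) / real n) (at_left 1)"
      by simp
    then have "\<forall>\<^sub>F lam in at_left 1. B lam < e"
      using n(1) by (rule order_tendstoD)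
    \<comment> \<open>The left neighbourhood is cut down to parameters for which
      \<open>u lam\<close> is known to be a solution.\<close>
    moreover have "\<forall>\<^sub>F lam in at_left 1. lam \<in> {0<..<1::real}"
      by (rule eventually_at_left_real) simp
    ultimately show "\<forall>\<^sub>F lam in at_left 1. \<forall>x\<in>X.
        dist (norm (u lam (T x) - \<Psi> x *v u lam x - \<rho> x)) 0 < e"
    proof eventually_elim
      case (elim lam)
      then have lam: "lam \<in> {0..<1}" by simp
      show ?case
      proof
        fix x assume x: "x \<in> X"
        have "\<rho> x = lam *\<^sub>R u lam (T x) - \<Psi> x *v u lam x"
          using sol[OF lam] x by (simp add: hyperbolized_solution_def)
        then have "u lam (T x) - \<Psi> x *v u lam x - \<rho> x = (1 - lam) *\<^sub>R u lam (T x)"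
          by (simp add: algebra_simps)
        then have "norm (u lam (T x) - \<Psi> x *v u lam x - \<rho> x) = (1 - lam) * norm (u lam (T x))"
          using lam by simp
        \<comment> \<open>\<open>B lam\<close> does not depend on \<open>x\<close>, whence the
          uniformity.\<close>
        also have "\<dots> \<le> B lam"
          unfolding B_def
          by (rule norm_hyperbolized_solution_le[OF assms(1) T orth R lam sol[OF lam] upper n(2)])
            (use T x in auto)
        also have "\<dots> < e" by (rule elim)
        finally show "dist (norm (u lam (T x) - \<Psi> x *v u lam x - \<rho> x)) 0 < e"
          by simp
      qed
    qed
  qed
qed

end
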